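(* Let $G=(V,E)$ be a finite connected graph with graph distance $d$ and diameter $\mathrm{diam}(G)$. Let $k\ge 1$ and let $x_1,\dots,x_k\in V$ be an arbitrary initial list of vertices (repetitions allowed), and extend it to an infinite sequence $(x_j)_{j=1}^\infty$ by the greedy rule: for every $j\ge k$, $x_{j+1}$ is any vertex satisfying $$\sum_{i=1}^{j} d(x_i,x_{j+1})=\max_{v\in V}\sum_{i=1}^{j} d(x_i,v).$$ For $m\ge 1$ let $\mu_m=\frac1m\sum_{i=1}^m\delta_{x_i}$ be the empirical probability measure of the first $m$ vertices. Then there exists a real number $\alpha$ with $\mathrm{diam}(G)/2\le\alpha\le\mathrm{diam}(G)$ such that: (1) $\displaystyle\lim_{m\to\infty}\sum_{v,w\in V}\mu_m(v)\,d(v,w)\,\mu_m(w)=\alpha$; (2) $\displaystyle\lim_{m\to\infty}\max_{v\in V}\sum_{w\in V}d(v,w)\,\mu_m(w)=\alpha$; (3) for every $\varepsilon>0$ there is $M$ such that for all $m\ge M$ and all $v\in V$: if $\mu_m(v)>\varepsilon$, then $\sum_{w\in V}d(v,w)\,\mu_m(w)\ge\alpha-\varepsilon$.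
   Context: $d(u,v)$ denotes the shortest-path distance in $G$ and $\mathrm{diam}(G)=\max_{u,v\in V}d(u,v)$. When the maximum in the greedy rule is attained at several vertices, any choice is allowed; the statement holds for every sequence so produced. *)

theory Defs
  imports
    "Graph_Theory.Digraph_Component"
    "Graph_Theory.Shortest_Path"
    "HOL-Probability.Probability_Mass_Function"
begin

text \<open>
  The library constant \<open>wf_digraph.\<mu> G f u v\<close> is the infimum, in \<open>ereal\<close>, of the costs of
  all walks from \<open>u\<close> to \<open>v\<close>. With unit weights the cost of a walk is its length. In a
  connected graph the infimum is finite, so the conversion to \<open>real\<close> loses nothing; between
  vertices that are not joined by a walk, \<open>gdist\<close> has the junk value 0.
\<close>

definition gdist :: "('a, 'b) pre_digraph \<Rightarrow> 'a \<Rightarrow> 'a \<Rightarrow> real" where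
  "gdist G u v = real_of_ereal (wf_digraph.\<mu> G (\<lambda>_. 1) u v)"

definition gdiam :: "('a, 'b) pre_digraph \<Rightarrow> real" where
  "gdiam G = (MAX (u, v) \<in> verts G \<times> verts G. gdist G u v)"

text \<open>
  The sequence is indexed from 1; \<open>x 0\<close> plays no role. For \<open>m \<ge> 1\<close> the image under \<open>x\<close> of
  the uniform distribution on \<open>{1..m}\<close> is the average of the point masses at
  \<open>x 1, \<dots>, x m\<close>, see \<open>pmf_empirical\<close>.
\<close>

definition empirical :: "(nat \<Rightarrow> 'a) \<Rightarrow> nat \<Rightarrow> 'a pmf" where
  "empirical x m = map_pmf x (pmf_of_set {1..m})"

lemma pmf_empirical:
  assumes "m \<ge> 1"
  shows "pmf (empirical x m) v = 1 / real m * (\<Sum>i=1..m. pmf (return_pmf (x i)) v)"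
proof -
  have ne: "{1..m} \<noteq> {}" using assms by simp
  have "pmf (empirical x m) v = real (card ({1..m} \<inter> x -` {v})) / real m"
    unfolding empirical_def pmf_map using ne by (subst measure_pmf_of_set) simp_all
  also have "real (card ({1..m} \<inter> x -` {v})) = (\<Sum>i=1..m. if x i = v then 1 else 0)"
    by (simp add: sum.If_cases Int_def vimage_def)
  also have "\<dots> = (\<Sum>i=1..m. pmf (return_pmf (x i)) v)"
    by (intro sum.cong refl) (auto simp: indicator_def)
  finally show ?thesis by simp
qed

lemma (in wf_digraph) gdist_eq_Least:
  assumes "u \<rightarrow>\<^sup>* v"
  shows "gdist G u v = real (LEAST n. \<exists>p. awalk u p v \<and> length p = n)"
proof -
  define n where "n = (LEAST n. \<exists>p. awalk u p v \<and> length p = n)"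
  have cost: "awalk_cost (\<lambda>_. 1) p = real (length p)" for p :: "'b list"
    by (induction p) (simp_all add: awalk_cost_def)
  obtain p0 where "awalk u p0 v" using assms reachable_awalk by blast
  then have ex: "\<exists>n p. awalk u p v \<and> length p = n" by blast
  obtain p where p: "awalk u p v" "length p = n"
    using LeastI_ex[OF ex] unfolding n_def by blast
  have least: "n \<le> length q" if "awalk u q v" for q
    unfolding n_def using that by (blast intro: Least_le)
  have "\<mu> (\<lambda>_. 1) u v = ereal (real n)"
    unfolding \<mu>_def
  proof (rule antisym)
    show "(INF p\<in>{p. awalk u p v}. ereal (awalk_cost (\<lambda>_. 1) p)) \<le> ereal (real n)"
      using p by (intro INF_lower2[of p]) (simp_all add: cost)
    show "ereal (real n) \<le> (INF p\<in>{p. awalk u p v}. ereal (awalk_cost (\<lambda>_. 1) p))"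
      using least by (intro INF_greatest) (simp add: cost)
  qed
  then show ?thesis by (simp add: gdist_def n_def)
qed

end

theory Submission
  imports Defs "HOL-Real_Asymp.Real_Asymp"
begin

text \<open>
  Let \<open>F\<^sub>m(v)\<close> be the sum of the distances from \<open>v\<close> to \<open>x\<^sub>1, \<dots>, x\<^sub>m\<close>, let \<open>M\<^sub>m\<close> be its maximum
  over \<open>v\<close>, and let \<open>E\<^sub>m\<close> be the sum of all \<open>d(x\<^sub>i, x\<^sub>j)\<close> with \<open>i, j \<le> m\<close>. The greedy rule gives
  \<open>E\<^sub>m\<^sub>+\<^sub>1 = E\<^sub>m + 2 M\<^sub>m\<close>, and \<open>E\<^sub>m \<le> m M\<^sub>m\<close> since a maximum dominates an average. Hence
  \<open>E\<^sub>m / (m (m + 1))\<close> is nondecreasing and converges to some \<open>\<alpha>\<close>. As \<open>M\<^sub>m\<close> is nondecreasing, a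
  monotone Tauberian argument yields \<open>M\<^sub>m / m \<longlonglongrightarrow> \<alpha>\<close>. The difference \<open>M\<^sub>m / m - E\<^sub>m / m\<^sup>2\<close> is the
  \<open>\<mu>\<^sub>m\<close>-average of the nonnegative deficits \<open>M\<^sub>m / m - F\<^sub>m(v) / m\<close> and tends to 0, so every vertex
  with non-negligible mass has a small deficit. The triangle inequality applied to a
  diametral pair gives \<open>\<alpha> \<ge> diam / 2\<close>.
\<close>

section \<open>Shortest-path distance as a metric\<close>

lemma (in wf_digraph) gdist_le_length:
  assumes "awalk u p v"
  shows "gdist G u v \<le> real (length p)"
proof -
  have "u \<rightarrow>\<^sup>* v" using assms reachable_awalk by blast
  then show ?thesis using assms by (auto simp: gdist_eq_Least intro: Least_le)
qed

lemma (in wf_digraph) gdist_attained: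
  assumes "u \<rightarrow>\<^sup>* v"
  obtains p where "awalk u p v" "gdist G u v = real (length p)"
proof -
  have "\<exists>n p. awalk u p v \<and> length p = n" using assms reachable_awalk by blast
  from LeastI_ex[OF this] show ?thesis using that assms by (auto simp: gdist_eq_Least)
qed

lemma (in wf_digraph) gdist_nonneg:
  assumes "u \<rightarrow>\<^sup>* v"
  shows "0 \<le> gdist G u v"
  using assms by (simp add: gdist_eq_Least)

lemma (in wf_digraph) gdist_self:
  assumes "u \<in> verts G"
  shows "gdist G u u = 0"
  using gdist_le_length[of u "[]" u] gdist_nonneg[of u u] assms by (simp add: awalk_Nil_iff)

lemma (in wf_digraph) gdist_triangle:
  assumes "u \<rightarrow>\<^sup>* v" "v \<rightarrow>\<^sup>* w"
  shows "gdist G u w \<le> gdist G u v + gdist G v w"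
proof -
  obtain p where p: "awalk u p v" "gdist G u v = real (length p)"
    using assms(1) by (rule gdist_attained)
  obtain q where q: "awalk v q w" "gdist G v w = real (length q)"
    using assms(2) by (rule gdist_attained)
  show ?thesis using gdist_le_length[OF awalk_appendI[OF p(1) q(1)]] p(2) q(2) by simp
qed

text \<open>Arcs are directed objects of their own, so \<open>p\<close> cannot just be read
  backwards: symmetry supplies for each arc one with swapped ends, and these are joined in reverse
  order.\<close>

lemma (in sym_digraph) awalk_reverse:
  assumes "awalk u p v"
  shows "\<exists>q. awalk v q u \<and> length q = length p"
  using assms
proof (induction p arbitrary: u)
  case Nil
  then show ?case by (auto simp: awalk_Nil_iff intro!: exI[of _ "[]"])
next
  case (Cons e p)
  then have e: "e \<in> arcs G" "u = tail G e" and w: "awalk (head G e) p v"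
    by (auto simp: awalk_Cons_iff)
  obtain q where q: "awalk v q (head G e)" "length q = length p" using Cons.IH[OF w] by blast
  obtain e' where e': "e' \<in> arcs G" "tail G e = head G e'" "head G e = tail G e'"
    using sym_arcs e(1) unfolding symmetric_conv by blast
  have "awalk (head G e) [e'] u"
    using e e' by (simp add: awalk_Cons_iff awalk_Nil_iff)
  then have "awalk v (q @ [e']) u" using q(1) awalk_appendI by blast
  then show ?case using q(2) by (intro exI[of _ "q @ [e']"]) simp
qed

lemma (in sym_digraph) gdist_commute:
  assumes "u \<rightarrow>\<^sup>* v"
  shows "gdist G u v = gdist G v u"
proof -
  have le: "gdist G b a \<le> gdist G a b" if "a \<rightarrow>\<^sup>* b" for a b
    using gdist_attained[OF that] awalk_reverse gdist_le_length by metis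
  have "v \<rightarrow>\<^sup>* u" using assms by (rule symmetric_reachable')
  then show ?thesis using le assms by (simp add: order_antisym)
qed

section \<open>The Tauberian step\<close>

text \<open>Recurrence and averaging give \<open>E (Suc m) \<ge> E m * (m + 2) / m\<close>. The
  sequence \<open>m * (m + 1)\<close> satisfies this with equality, so it is the normalisation that
  makes the quotient monotone; plain \<open>m\<^sup>2\<close> comes back only in the limit.\<close>

lemma energy_ratio_convergent:
  fixes E M :: "nat \<Rightarrow> real"
  assumes step: "\<And>m. m \<ge> k \<Longrightarrow> E (Suc m) = E m + 2 * M m"
    and average: "\<And>m. m \<ge> k \<Longrightarrow> E m \<le> real m * M m"
    and bound: "\<And>m. E m \<le> C * (real m)\<^sup>2"
    and "k \<ge> 1" "C \<ge> 0"
  shows "\<exists>\<alpha>. (\<lambda>m. E m / (real m)\<^sup>2) \<longlonglongrightarrow> \<alpha>"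
proof -
  \<comment> \<open>The shift by \<open>k\<close> starts \<open>c\<close> where the recurrence holds
    and, as \<open>k \<ge> 1\<close>, keeps the denominator positive.\<close>
  define c where "c n = E (n + k) / (real (n + k) * real (n + k + 1))" for n
  have "incseq c"
  proof (rule incseq_SucI)
    fix n
    define r where "r = real (n + k)"
    have r: "r \<ge> 1" using \<open>k \<ge> 1\<close> by (simp add: r_def)
    have "E (n + k) * (r + 2) \<le> (E (n + k) + 2 * M (n + k)) * r"
      using average[of "n + k"] by (simp add: r_def algebra_simps)
    then have "E (n + k) * (r + 2) \<le> E (Suc (n + k)) * r" by (simp add: step)
    then have "E (n + k) * (r + 2) * (r + 1) \<le> E (Suc (n + k)) * r * (r + 1)"
      using r by (intro mult_right_mono) auto
    then have "E (n + k) / (r * (r + 1)) \<le> E (Suc (n + k)) / ((r + 1) * (r + 2))"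
      using r by (simp add: divide_le_eq pos_le_divide_eq mult_ac)
    then show "c n \<le> c (Suc n)" by (simp add: c_def r_def add_ac)
  qed
  moreover have "c n \<le> C" for n
  proof -
    define r where "r = real (n + k)"
    have r: "r \<ge> 1" using \<open>k \<ge> 1\<close> by (simp add: r_def)
    have "E (n + k) \<le> C * r\<^sup>2" using bound[of "n + k"] by (simp add: r_def)
    also have "\<dots> \<le> C * (r * (r + 1))"
      using r \<open>C \<ge> 0\<close> by (intro mult_left_mono) (simp_all add: power2_eq_square)
    finally show ?thesis using r by (simp add: c_def r_def divide_le_eq add_ac)
  qed
  ultimately obtain \<alpha> where "c \<longlonglongrightarrow> \<alpha>" using incseq_convergent by metis
  moreover have "(\<lambda>n. (real (n + k) + 1) / real (n + k)) \<longlonglongrightarrow> 1" by real_asymp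
  ultimately have "(\<lambda>n. c n * ((real (n + k) + 1) / real (n + k))) \<longlonglongrightarrow> \<alpha> * 1"
    by (rule tendsto_mult)
  moreover have "c n * ((real (n + k) + 1) / real (n + k)) = E (n + k) / (real (n + k))\<^sup>2" for n
  proof -
    define r where "r = real (n + k)"
    have "r \<ge> 1" using \<open>k \<ge> 1\<close> by (simp add: r_def)
    then have "E (n + k) / (r * (r + 1)) * ((r + 1) / r) = E (n + k) / r\<^sup>2"
      by (simp add: power2_eq_square)
    then show ?thesis by (simp add: c_def r_def add_ac)
  qed
  ultimately have "(\<lambda>n. E (n + k) / (real (n + k))\<^sup>2) \<longlonglongrightarrow> \<alpha>"
    by (simp only: mult_1_right)
  then have "(\<lambda>m. E m / (real m)\<^sup>2) \<longlonglongrightarrow> \<alpha>" by (rule LIMSEQ_offset)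
  then show ?thesis ..
qed

text \<open>
  For the upper bound, \<open>M\<close> being nondecreasing gives \<open>2 n M\<^sub>m \<le> E\<^sub>m\<^sub>+\<^sub>n - E\<^sub>m\<close>; take \<open>n \<approx> \<delta> m\<close> and
  approximate \<open>E\<^sub>m / m\<^sup>2\<close> up to \<open>\<delta>\<^sup>2\<close>, so that the error stays small after division by \<open>\<delta>\<close>.
\<close>

lemma slope_tendsto:
  fixes E M :: "nat \<Rightarrow> real"
  assumes step: "\<And>m. m \<ge> k \<Longrightarrow> E (Suc m) = E m + 2 * M m"
    and average: "\<And>m. m \<ge> k \<Longrightarrow> E m \<le> real m * M m"
    and mono: "\<And>m. M m \<le> M (Suc m)"
    and "k \<ge> 1"
    and lim: "(\<lambda>m. E m / (real m)\<^sup>2) \<longlonglongrightarrow> \<alpha>"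
    and "\<alpha> \<ge> 0"
  shows "(\<lambda>m. M m / real m) \<longlonglongrightarrow> \<alpha>"
proof (rule order_tendstoI)
  fix a assume "a < \<alpha>"
  with lim have "\<forall>\<^sub>F m in sequentially. a < E m / (real m)\<^sup>2" by (rule order_tendstoD)
  then show "\<forall>\<^sub>F m in sequentially. a < M m / real m"
    using eventually_ge_at_top[of k]
  proof eventually_elim
    case (elim m)
    have "E m / (real m)\<^sup>2 \<le> (real m * M m) / (real m)\<^sup>2"
      using average[OF elim(2)] by (rule divide_right_mono) simp
    also have "\<dots> = M m / real m" using elim \<open>k \<ge> 1\<close> by (simp add: power2_eq_square)
    finally show ?case using elim by simp
  qed
next
  fix a assume "\<alpha> < a"
  \<comment> \<open>This expression is the bound on \<open>M m / real m\<close> reached at the end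
    of the estimate; since it tends to \<alpha>, some \<delta> > 0 brings it below
    \<open>a\<close>.\<close>
  have "((\<lambda>\<delta>. (\<alpha> + \<delta>\<^sup>2) * (1 + \<delta>) + \<delta>) \<longlongrightarrow> (\<alpha> + 0\<^sup>2) * (1 + 0) + 0) (at_right (0::real))"
    by (intro tendsto_intros)
  with \<open>\<alpha> < a\<close> have "\<forall>\<^sub>F \<delta> in at_right (0::real). (\<alpha> + \<delta>\<^sup>2) * (1 + \<delta>) + \<delta> < a"
    by (intro order_tendstoD) auto
  then have "\<forall>\<^sub>F \<delta> in at_right (0::real). 0 < \<delta> \<and> (\<alpha> + \<delta>\<^sup>2) * (1 + \<delta>) + \<delta> < a"
    using eventually_at_right_less[of 0] by eventually_elim simp
  then obtain \<delta> :: real where \<delta>: "0 < \<delta>" "(\<alpha> + \<delta>\<^sup>2) * (1 + \<delta>) + \<delta> < a"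
    using eventually_happens'[OF trivial_limit_at_right_real] by blast
  have grow: "E m + 2 * real n * M m \<le> E (m + n)" if "m \<ge> k" for m n
  proof (induction n)
    case (Suc n)
    have "M m \<le> M (m + n)" using lift_Suc_mono_le[of M, OF mono] by simp
    then show ?case using Suc step[of "m + n"] that by (simp add: algebra_simps)
  qed simp
  have "\<forall>\<^sub>F m in sequentially. \<alpha> - \<delta>\<^sup>2 < E m / (real m)\<^sup>2" "\<forall>\<^sub>F m in sequentially. E m / (real m)\<^sup>2 < \<alpha> + \<delta>\<^sup>2"
    using order_tendstoD[OF lim] \<delta>(1) by auto
  then have "\<forall>\<^sub>F m in sequentially. \<alpha> - \<delta>\<^sup>2 < E m / (real m)\<^sup>2 \<and> E m / (real m)\<^sup>2 < \<alpha> + \<delta>\<^sup>2"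
    by eventually_elim simp
  then obtain N where N: "\<And>m. m \<ge> N \<Longrightarrow> \<alpha> - \<delta>\<^sup>2 < E m / (real m)\<^sup>2 \<and> E m / (real m)\<^sup>2 < \<alpha> + \<delta>\<^sup>2"
    unfolding eventually_sequentially by blast
  show "\<forall>\<^sub>F m in sequentially. M m / real m < a"
    using eventually_ge_at_top[of N] eventually_ge_at_top[of k]
      eventually_ge_at_top[of "nat \<lceil>1 / \<delta>\<rceil>"]
  proof eventually_elim
    case (elim m)
    define n where "n = nat \<lceil>\<delta> * real m\<rceil>"
    define r where "r = real m"
    define s where "s = real n"
    have r: "r \<ge> 1" using elim \<open>k \<ge> 1\<close> by (simp add: r_def)
    \<comment> \<open>The third threshold on \<open>m\<close> is used here: once
      \<open>\<delta> * r\<close> is at least 1, rounding it up at most doubles it.\<close>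
    have "1 \<le> \<delta> * r" using elim(3) \<delta>(1) by (simp add: r_def divide_le_eq mult.commute nat_ceiling_le_eq)
    then have s: "\<delta> * r \<le> s" "s \<le> 2 * \<delta> * r" "0 < s"
      unfolding s_def n_def r_def by linarith+
    have "(\<alpha> - \<delta>\<^sup>2) * r\<^sup>2 + 2 * s * M m \<le> E m + 2 * s * M m"
      using N[OF elim(1)] r by (simp add: r_def less_divide_eq)
    also have "\<dots> \<le> E (m + n)" using grow[OF elim(2)] by (simp add: s_def)
    also have "\<dots> \<le> (\<alpha> + \<delta>\<^sup>2) * (r + s)\<^sup>2"
      using N[of "m + n"] elim(1) r by (simp add: r_def s_def divide_less_eq split: if_splits)
    \<comment> \<open>The leading terms cancel through
      \<open>(r + s)\<^sup>2 - r\<^sup>2 = (2 * r + s) * s\<close>. The remaining error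
      \<open>2 * \<delta>\<^sup>2 * r\<^sup>2\<close> is then turned into a multiple of
      \<open>s\<close> by \<open>\<delta> * r \<le> s\<close>, so that \<open>s\<close> can be
      divided out.\<close>
    finally have "2 * s * M m \<le> (\<alpha> + \<delta>\<^sup>2) * (2 * r + s) * s + 2 * \<delta>\<^sup>2 * r\<^sup>2"
      by (simp add: algebra_simps power2_eq_square)
    also have "2 * \<delta>\<^sup>2 * r\<^sup>2 \<le> 2 * (\<delta> * r) * s"
      using mult_left_mono[OF s(1), of "2 * (\<delta> * r)"] \<delta>(1) r
      by (simp add: power2_eq_square mult_ac)
    finally have "s * (2 * M m) \<le> s * ((\<alpha> + \<delta>\<^sup>2) * (2 * r + s) + 2 * (\<delta> * r))"
      by (simp add: algebra_simps)
    then have "2 * M m \<le> (\<alpha> + \<delta>\<^sup>2) * (2 * r + s) + 2 * (\<delta> * r)"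
      using s(3) by (simp add: mult_le_cancel_left_pos)
    also have "\<dots> \<le> (\<alpha> + \<delta>\<^sup>2) * (2 * r + 2 * \<delta> * r) + 2 * (\<delta> * r)"
      using s(2) \<open>\<alpha> \<ge> 0\<close> \<delta>(1) by (intro add_mono mult_left_mono) auto
    also have "\<dots> = 2 * (r * ((\<alpha> + \<delta>\<^sup>2) * (1 + \<delta>) + \<delta>))" by (simp add: algebra_simps)
    finally have "M m / r \<le> (\<alpha> + \<delta>\<^sup>2) * (1 + \<delta>) + \<delta>"
      using r by (simp add: divide_le_eq mult.commute)
    then show ?case using \<delta>(2) by (simp add: r_def)
  qed
qed

section \<open>Greedy sequences in finite metric spaces\<close>

text \<open>Turns integrals against the empirical measure into averages along the sequence. All
  listed points must lie in \<open>V\<close>, or the left side would miss their mass.\<close>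

lemma sum_pmf_empirical:
  fixes f :: "'a \<Rightarrow> real"
  assumes "m \<ge> 1" "finite V" "\<And>i. i \<in> {1..m} \<Longrightarrow> x i \<in> V"
  shows "(\<Sum>v\<in>V. f v * pmf (empirical x m) v) = (\<Sum>i=1..m. f (x i)) / real m"
proof -
  have "(\<Sum>v\<in>V. f v * pmf (empirical x m) v)
      = (\<Sum>v\<in>V. \<Sum>i=1..m. f v * pmf (return_pmf (x i)) v) / real m"
    unfolding pmf_empirical[OF assms(1)] sum_divide_distrib sum_distrib_left by simp
  also have "(\<Sum>v\<in>V. \<Sum>i=1..m. f v * pmf (return_pmf (x i)) v)
      = (\<Sum>i=1..m. \<Sum>v\<in>V. f v * pmf (return_pmf (x i)) v)"
    by (rule sum.swap)
  also have "\<dots> = (\<Sum>i=1..m. f (x i))"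
  proof (rule sum.cong[OF refl])
    fix i assume "i \<in> {1..m}"
    then have "x i \<in> V" by (rule assms(3))
    have "(\<Sum>v\<in>V. f v * pmf (return_pmf (x i)) v) = (\<Sum>v\<in>V. if v = x i then f v else 0)"
      by (intro sum.cong) (auto simp: indicator_def)
    then show "(\<Sum>v\<in>V. f v * pmf (return_pmf (x i)) v) = f (x i)"
      using assms(2) \<open>x i \<in> V\<close> by simp
  qed
  finally show ?thesis .
qed

text \<open>Walks no longer matter here: the argument runs on a finite set with a symmetric
  nonnegative \<open>d\<close> that vanishes on the diagonal and obeys the triangle
  inequality.\<close>

lemma greedy_empirical_limit:
  fixes d :: "'a \<Rightarrow> 'a \<Rightarrow> real"
  assumes V: "finite V" "V \<noteq> {}"
    and nonneg: "\<And>u v. u \<in> V \<Longrightarrow> v \<in> V \<Longrightarrow> 0 \<le> d u v"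
    and self: "\<And>u. u \<in> V \<Longrightarrow> d u u = 0"
    and commute: "\<And>u v. u \<in> V \<Longrightarrow> v \<in> V \<Longrightarrow> d u v = d v u"
    and triangle: "\<And>u v w. u \<in> V \<Longrightarrow> v \<in> V \<Longrightarrow> w \<in> V \<Longrightarrow> d u w \<le> d u v + d v w"
    and k: "k \<ge> 1"
    and x: "\<And>i. i \<ge> 1 \<Longrightarrow> x i \<in> V"
    and greedy: "\<And>j. j \<ge> k \<Longrightarrow>
      (\<Sum>i=1..j. d (x i) (x (Suc j))) = (MAX v\<in>V. \<Sum>i=1..j. d (x i) v)"
    and D: "D = (MAX (u, v) \<in> V \<times> V. d u v)"
  shows "\<exists>\<alpha>. D / 2 \<le> \<alpha> \<and> \<alpha> \<le> D \<and>
    (\<lambda>m. \<Sum>v\<in>V. \<Sum>w\<in>V. pmf (empirical x m) v * d v w * pmf (empirical x m) w) \<longlonglongrightarrow> \<alpha> \<and>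
    (\<lambda>m. MAX v\<in>V. \<Sum>w\<in>V. d v w * pmf (empirical x m) w) \<longlonglongrightarrow> \<alpha> \<and>
    (\<forall>\<epsilon>>0. \<exists>M\<ge>1. \<forall>m\<ge>M. \<forall>v\<in>V. pmf (empirical x m) v > \<epsilon> \<longrightarrow>
        (\<Sum>w\<in>V. d v w * pmf (empirical x m) w) \<ge> \<alpha> - \<epsilon>)"
proof -
  define F where "F m v = (\<Sum>i=1..m. d (x i) v)" for m v
  define M where "M m = (MAX v\<in>V. F m v)" for m
  define E where "E m = (\<Sum>i=1..m. F m (x i))" for m
  define p where "p m = pmf (empirical x m)" for m
  have F_le: "F m v \<le> M m" if "v \<in> V" for m v
    unfolding M_def using V that by simp
  have M_le: "M m \<le> B" if "\<And>v. v \<in> V \<Longrightarrow> F m v \<le> B" for m B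
    unfolding M_def using V that by simp
  have potential: "(\<Sum>w\<in>V. d v w * p m w) = F m v / real m" if "m \<ge> 1" "v \<in> V" for m v
  proof -
    have "(\<Sum>w\<in>V. d v w * p m w) = (\<Sum>i=1..m. d v (x i)) / real m"
      unfolding p_def using that V x by (intro sum_pmf_empirical) auto
    also have "(\<Sum>i=1..m. d v (x i)) = F m v"
      unfolding F_def using that x by (intro sum.cong) (auto simp: commute)
    finally show ?thesis .
  qed
  have mean: "(\<Sum>v\<in>V. p m v * (F m v / real m)) = E m / (real m)\<^sup>2" if "m \<ge> 1" for m
  proof -
    have "(\<Sum>v\<in>V. F m v / real m * p m v) = (\<Sum>i=1..m. F m (x i) / real m) / real m"
      unfolding p_def using that V x by (intro sum_pmf_empirical) auto
    then show ?thesis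
      by (simp add: E_def mult.commute power2_eq_square flip: sum_divide_distrib)
  qed
  have energy: "(\<Sum>v\<in>V. \<Sum>w\<in>V. p m v * d v w * p m w) = E m / (real m)\<^sup>2" if "m \<ge> 1" for m
  proof -
    have "(\<Sum>v\<in>V. \<Sum>w\<in>V. p m v * d v w * p m w) = (\<Sum>v\<in>V. p m v * (F m v / real m))"
      using that by (intro sum.cong refl) (simp add: sum_distrib_left mult.assoc flip: potential)
    then show ?thesis using mean[OF that] by simp
  qed
  have mass: "(\<Sum>v\<in>V. p m v) = 1" if "m \<ge> 1" for m
    using sum_pmf_empirical[of m V x "\<lambda>_. 1"] that V x by (simp add: p_def)
  have maximum: "(MAX v\<in>V. \<Sum>w\<in>V. d v w * p m w) = M m / real m" if "m \<ge> 1" for m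
  proof -
    have "(MAX v\<in>V. \<Sum>w\<in>V. d v w * p m w) = (MAX v\<in>V. F m v / real m)"
      using potential[OF that] by (intro arg_cong[where f = Max] image_cong) auto
    also have "\<dots> = M m / real m"
    proof (rule Max_eqI)
      show "M m / real m \<in> (\<lambda>v. F m v / real m) ` V"
      proof -
        have "M m \<in> F m ` V" unfolding M_def using V by (intro Max_in) auto
        then show ?thesis by auto
      qed
    qed (use V F_le in \<open>auto intro: divide_right_mono\<close>)
    finally show ?thesis .
  qed
  have step: "E (Suc m) = E m + 2 * M m" if "m \<ge> k" for m
  proof -
    have xV: "x (Suc m) \<in> V" by (rule x) simp
    \<comment> \<open>The new point adds a row, a column and a diagonal entry to the distance
      matrix. Row and column sums agree by symmetry and equal \<open>M m\<close> by greediness; the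
      diagonal entry is 0.\<close>
    have "E (Suc m) = (\<Sum>i=1..m. F m (x i) + d (x (Suc m)) (x i))
        + (F m (x (Suc m)) + d (x (Suc m)) (x (Suc m)))"
      by (simp add: E_def F_def)
    also have "(\<Sum>i=1..m. F m (x i) + d (x (Suc m)) (x i)) = E m + (\<Sum>i=1..m. d (x (Suc m)) (x i))"
      by (simp add: E_def sum.distrib)
    also have "(\<Sum>i=1..m. d (x (Suc m)) (x i)) = F m (x (Suc m))"
      unfolding F_def using x xV by (intro sum.cong) (auto simp: commute)
    also have "F m (x (Suc m)) = M m" using greedy[OF that] by (simp add: F_def M_def)
    finally show ?thesis using self[OF xV] by simp
  qed
  have average: "E m \<le> real m * M m" for m
  proof -
    have "E m \<le> (\<Sum>i=1..m. M m)" unfolding E_def using x F_le by (intro sum_mono) auto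
    then show ?thesis by simp
  qed
  have M_mono: "M m \<le> M (Suc m)" for m
  proof (rule M_le)
    fix v assume v: "v \<in> V"
    have "F m v \<le> F (Suc m) v" using nonneg[of "x (Suc m)" v] x v by (simp add: F_def)
    also have "\<dots> \<le> M (Suc m)" using v by (rule F_le)
    finally show "F m v \<le> M (Suc m)" .
  qed
  have d_le: "d u v \<le> D" if "u \<in> V" "v \<in> V" for u v
    unfolding D using V that by (intro Max_ge) auto
  have D_nonneg: "0 \<le> D" using V nonneg d_le by (meson all_not_in_conv order_trans)
  have M_upper: "M m \<le> D * real m" for m
  proof (rule M_le)
    fix v assume "v \<in> V"
    then have "F m v \<le> (\<Sum>i=1..m. D)" unfolding F_def using x d_le by (intro sum_mono) auto
    then show "F m v \<le> D * real m" by (simp add: mult.commute)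
  qed
  have M_lower: "D / 2 * real m \<le> M m" for m
  proof -
    \<comment> \<open>For a diametral pair \<open>u\<close>, \<open>v\<close>, the triangle
      inequality through each \<open>x i\<close> shows that \<open>F m u\<close> and
      \<open>F m v\<close> together reach \<open>m * D\<close>, so the larger one is at least half
      of that.\<close>
    have "D \<in> (\<lambda>(u, v). d u v) ` (V \<times> V)" unfolding D using V by (intro Max_in) auto
    then obtain u v where uv: "u \<in> V" "v \<in> V" "D = d u v" by auto
    have "real m * D = (\<Sum>i=1..m. d u v)" by (simp add: uv)
    also have "\<dots> \<le> (\<Sum>i=1..m. d (x i) u + d (x i) v)"
    proof (rule sum_mono)
      fix i assume "i \<in> {1..m}"
      then have "x i \<in> V" using x by simp
      then show "d u v \<le> d (x i) u + d (x i) v"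
        using triangle[of u "x i" v] commute[of u "x i"] uv by simp
    qed
    also have "\<dots> = F m u + F m v" by (simp add: F_def sum.distrib)
    also have "\<dots> \<le> 2 * M m" using F_le[OF uv(1), of m] F_le[OF uv(2), of m] by simp
    finally show ?thesis by (simp add: mult.commute)
  qed
  have "E m \<le> D * (real m)\<^sup>2" for m
  proof -
    have "real m * M m \<le> real m * (D * real m)" by (intro mult_left_mono M_upper) simp
    then show ?thesis using average[of m] by (simp add: power2_eq_square mult_ac)
  qed
  then obtain \<alpha> where E_lim: "(\<lambda>m. E m / (real m)\<^sup>2) \<longlonglongrightarrow> \<alpha>"
    using energy_ratio_convergent[of k E M D] step average k D_nonneg by blast
  have "0 \<le> E m" for m
    unfolding E_def F_def using x nonneg by (intro sum_nonneg) auto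
  then have "0 \<le> \<alpha>" using E_lim by (intro LIMSEQ_le_const) auto
  have M_lim: "(\<lambda>m. M m / real m) \<longlonglongrightarrow> \<alpha>"
    using slope_tendsto[of k E M \<alpha>] step average M_mono k E_lim \<open>0 \<le> \<alpha>\<close> by blast
  \<comment> \<open>The bound is used from index 1 on: at \<open>m = 0\<close> the quotient is 0 by
    convention, which may lie below \<open>D / 2\<close>.\<close>
  have "D / 2 \<le> \<alpha>"
    using M_lim by (rule LIMSEQ_le_const) (use M_lower in \<open>auto simp: le_divide_eq intro!: exI[of _ 1]\<close>)
  moreover have "\<alpha> \<le> D"
    using M_lim by (rule LIMSEQ_le_const2) (use M_upper in \<open>auto simp: divide_le_eq intro!: exI[of _ 1]\<close>)
  \<comment> \<open>\<open>empirical x 0\<close> would come from a uniform distribution on the empty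
    set, so the formulas for energy and maximum are transferred from \<open>m = 1\<close>
    on.\<close>
  moreover have "(\<lambda>m. \<Sum>v\<in>V. \<Sum>w\<in>V. p m v * d v w * p m w) \<longlonglongrightarrow> \<alpha>"
    using E_lim by (rule Lim_transform_eventually)
      (auto simp: energy eventually_sequentially intro!: exI[of _ 1])
  moreover have "(\<lambda>m. MAX v\<in>V. \<Sum>w\<in>V. d v w * p m w) \<longlonglongrightarrow> \<alpha>"
    using M_lim by (rule Lim_transform_eventually)
      (auto simp: maximum eventually_sequentially intro!: exI[of _ 1])
  moreover have "\<exists>N\<ge>1. \<forall>m\<ge>N. \<forall>v\<in>V. p m v > \<epsilon> \<longrightarrow> (\<Sum>w\<in>V. d v w * p m w) \<ge> \<alpha> - \<epsilon>"
    if \<epsilon>: "\<epsilon> > 0" for \<epsilon>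
  proof -
    have "(\<lambda>m. M m / real m - E m / (real m)\<^sup>2) \<longlonglongrightarrow> 0"
      using tendsto_diff[OF M_lim E_lim] by simp
    \<comment> \<open>The tolerance is split in two: an average deficit below
      \<open>\<epsilon> * (\<epsilon> / 2)\<close> forces a deficit below
      \<open>\<epsilon> / 2\<close> at any vertex of mass above \<epsilon>, and the other
      \<open>\<epsilon> / 2\<close> pays for replacing \<open>M m / real m\<close> by
      \<alpha>.\<close>
    then have "\<forall>\<^sub>F m in sequentially. M m / real m - E m / (real m)\<^sup>2 < \<epsilon> * (\<epsilon> / 2)"
      by (rule order_tendstoD) (use \<epsilon> in simp)
    moreover have "\<forall>\<^sub>F m in sequentially. \<alpha> - \<epsilon> / 2 < M m / real m"
      using M_lim by (rule order_tendstoD) (use \<epsilon> in simp)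
    ultimately have "\<forall>\<^sub>F m in sequentially.
        M m / real m - E m / (real m)\<^sup>2 < \<epsilon> * (\<epsilon> / 2) \<and> \<alpha> - \<epsilon> / 2 < M m / real m"
      by eventually_elim simp
    then obtain N where N: "\<And>m. m \<ge> N \<Longrightarrow>
        M m / real m - E m / (real m)\<^sup>2 < \<epsilon> * (\<epsilon> / 2) \<and> \<alpha> - \<epsilon> / 2 < M m / real m"
      unfolding eventually_sequentially by blast
    show ?thesis
    proof (intro exI[of _ "max N 1"] conjI allI impI ballI)
      fix m v assume m: "max N 1 \<le> m" and v: "v \<in> V" and pv: "p m v > \<epsilon>"
      define deficit where "deficit u = M m / real m - F m u / real m" for u
      have deficit_nonneg: "0 \<le> deficit u" if "u \<in> V" for u
        using divide_right_mono[OF F_le[OF that], of "real m" m] by (simp add: deficit_def)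
      have "\<epsilon> * deficit v \<le> p m v * deficit v"
        using pv deficit_nonneg[OF v] by (intro mult_right_mono) auto
      also have "\<dots> \<le> (\<Sum>u\<in>V. p m u * deficit u)"
        using V v deficit_nonneg by (intro member_le_sum) (auto simp: p_def)
      also have "\<dots> = M m / real m - E m / (real m)\<^sup>2"
        using m mass[of m] mean[of m]
        by (simp add: deficit_def right_diff_distrib sum_subtractf flip: sum_distrib_right sum_divide_distrib)
      also have "\<dots> < \<epsilon> * (\<epsilon> / 2)" using N m by simp
      finally have "deficit v < \<epsilon> / 2" using \<epsilon> by (simp add: mult_less_cancel_left_pos)
      moreover have "\<alpha> - \<epsilon> / 2 < M m / real m" using N m by simp
      ultimately show "(\<Sum>w\<in>V. d v w * p m w) \<ge> \<alpha> - \<epsilon>"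
        using potential[of m v] m v unfolding deficit_def by linarith
    qed simp
  qed
  ultimately show ?thesis unfolding p_def by blast
qed

theorem theorem1:
  fixes G :: "('a, 'b) pre_digraph" and x :: "nat \<Rightarrow> 'a" and k :: nat
  assumes "graph G" and "Digraph_Component.connected G"
    and "k \<ge> 1"
    and initial: "\<forall>i\<in>{1..k}. x i \<in> verts G"
    and greedy: "\<forall>j\<ge>k. x (j + 1) \<in> verts G \<and>
      (\<Sum>i=1..j. gdist G (x i) (x (j + 1))) = (MAX v\<in>verts G. \<Sum>i=1..j. gdist G (x i) v)"
  shows "\<exists>\<alpha>::real. gdiam G / 2 \<le> \<alpha> \<and> \<alpha> \<le> gdiam G \<and>
    (\<lambda>m. \<Sum>v\<in>verts G. \<Sum>w\<in>verts G.
        pmf (empirical x m) v * gdist G v w * pmf (empirical x m) w) \<longlonglongrightarrow> \<alpha> \<and>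
    (\<lambda>m. MAX v\<in>verts G. \<Sum>w\<in>verts G. gdist G v w * pmf (empirical x m) w) \<longlonglongrightarrow> \<alpha> \<and>
    (\<forall>\<epsilon>>0. \<exists>M\<ge>1. \<forall>m\<ge>M. \<forall>v\<in>verts G. pmf (empirical x m) v > \<epsilon> \<longrightarrow>
        (\<Sum>w\<in>verts G. gdist G v w * pmf (empirical x m) w) \<ge> \<alpha> - \<epsilon>)"
proof -
  interpret graph G by fact
  \<comment> \<open>Walks between all pairs of vertices rule out the junk value of
    \<open>gdist\<close> and discharge the reachability premises of the metric lemmas.\<close>
  have "strongly_connected G"
    using symmetric_connected_imp_strongly_connected sym_arcs assms(2) by blast
  then have ne: "verts G \<noteq> {}"
    and reach: "\<And>u v. u \<in> verts G \<Longrightarrow> v \<in> verts G \<Longrightarrow> u \<rightarrow>\<^sup>*\<^bsub>G\<^esub> v"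
    by (auto simp: strongly_connected_def)
  have x: "x i \<in> verts G" if "i \<ge> 1" for i
  proof (cases "i \<le> k")
    case False
    then show ?thesis using greedy[rule_format, of "i - 1"] by auto
  qed (use initial that in auto)
  show ?thesis
  proof (rule greedy_empirical_limit)
    show "gdiam G = (MAX (u, v) \<in> verts G \<times> verts G. gdist G u v)" by (rule gdiam_def)
    show "(\<Sum>i=1..j. gdist G (x i) (x (Suc j))) = (MAX v\<in>verts G. \<Sum>i=1..j. gdist G (x i) v)"
      if "j \<ge> k" for j
      using greedy that by simp
  qed (use ne reach x \<open>k \<ge> 1\<close> in
      \<open>auto intro: gdist_nonneg gdist_self gdist_commute gdist_triangle\<close>)
qed

end
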